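(* Any (probabilistic bounded error or deterministic) symbolic algorithm that, given an undirected connected graph with $n$ vertices whose diameter is either $2$ or $3$, decides which of the two is the case needs $\Omega(n)$ symbolic one-step operations.
   Context: Symbolic model: the input is a finite graph $G=(V,E)$, $n=|V|$; an undirected graph is regarded as a directed graph with symmetric edge relation. The algorithm knows $V$, but it can access $E$ only through the one-step operations $\mathrm{Pre}(S)=\{v\in V\mid \exists s\in S:(v,s)\in E\}$ and $\mathrm{Post}(S)=\{v\in V\mid \exists s\in S:(s,v)\in E\}$ (equal for undirected graphs) applied to (adaptively chosen) sets $S\subseteq V$. All other computation, in particular basic set operations on vertex sets, is unrestricted and not counted in lower bounds; any number of sets may be stored. A probabilistic bounded error algorithm may use random bits and must be correct with probability at least $2/3$ on every admissible input (here: every undirected connected graph of diameter $2$ or $3$). The diameter of a connected undirected graph is the maximum distance between two of its vertices. Convention for lower bounds: "needs $\Omega(n)$ one-step operations" means: there is an absolute constant $c>0$ such that every (deterministic or probabilistic bounded error) symbolic algorithm that is correct on all admissible inputs performs, on admissible inputs with arbitrarily large $n$, at least $c\cdot n$ one-step operations (worst case over its random choices). *)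

theory Defs
  imports
    "HOL-Probability.Probability"
    "Graph_Theory.Graph_Theory"
begin

definition gdist :: "'v pair_pre_digraph \<Rightarrow> 'v \<Rightarrow> 'v \<Rightarrow> ereal" where
  "gdist G u v = wf_digraph.\<mu> (with_proj G) (\<lambda>_. 1) u v"

definition gdiameter :: "'v pair_pre_digraph \<Rightarrow> ereal" where
  "gdiameter G = Max {gdist G u v | u v. u \<in> pverts G \<and> v \<in> pverts G}"

text \<open>
  The locale \<open>pair_graph\<close> describes finite symmetric digraphs without loops. Excluding loops
  makes the lower bound stronger: fewer inputs have to be answered correctly, and the
  expensive inputs have to be found among the loop-free ones.
\<close>

definition admissible :: "'v pair_pre_digraph \<Rightarrow> bool" where
  "admissible G \<longleftrightarrow>
     pair_graph G \<and> Digraph_Component.connected (with_proj G) \<and> (gdiameter G = 2 \<or> gdiameter G = 3)"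

definition pre_op :: "'v pair_pre_digraph \<Rightarrow> 'v set \<Rightarrow> 'v set" where
  "pre_op G S = {v \<in> pverts G. \<exists>s\<in>S. (v, s) \<in> parcs G}"

definition post_op :: "'v pair_pre_digraph \<Rightarrow> 'v set \<Rightarrow> 'v set" where
  "post_op G S = {v \<in> pverts G. \<exists>s\<in>S. (s, v) \<in> parcs G}"

text \<open>
  Computation between one-step operations is unrestricted and free of charge, so an algorithm
  is an arbitrary function from the list of results of the one-step operations performed so
  far to its next action. Nothing forces it to terminate. The argument of an operation need
  not be a set of vertices, since elements outside the vertex set do not affect the result.
\<close>

datatype 'v action = Pre "'v set" | Post "'v set" | Output nat

type_synonym 'v strategy = "'v set list \<Rightarrow> 'v action"

text \<open>Both kinds of algorithm know the vertex set; a probabilistic one also has access to an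
  infinite sequence of fair coin flips.\<close>

type_synonym 'v det_alg = "'v set \<Rightarrow> 'v strategy"
type_synonym 'v prob_alg = "'v set \<Rightarrow> bool stream \<Rightarrow> 'v strategy"

definition coins :: "bool stream measure" where
  "coins = stream_space (measure_pmf (bernoulli_pmf (1/2)))"

inductive_set histories :: "'v pair_pre_digraph \<Rightarrow> 'v strategy \<Rightarrow> 'v set list set"
  for G :: "'v pair_pre_digraph" and A :: "'v strategy" where
  start: "[] \<in> histories G A"
| pre: "h \<in> histories G A \<Longrightarrow> A h = Pre S \<Longrightarrow> h @ [pre_op G S] \<in> histories G A"
| post: "h \<in> histories G A \<Longrightarrow> A h = Post S \<Longrightarrow> h @ [post_op G S] \<in> histories G A"

definition num_ops :: "'v pair_pre_digraph \<Rightarrow> 'v strategy \<Rightarrow> ereal" where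
  "num_ops G A = (SUP h\<in>histories G A. ereal (real (length h)))"

definition outputs_diameter :: "'v pair_pre_digraph \<Rightarrow> 'v strategy \<Rightarrow> bool" where
  "outputs_diameter G A \<longleftrightarrow>
     (\<exists>h\<in>histories G A. \<exists>d. A h = Output d \<and> gdiameter G = ereal (real d))"

definition det_correct :: "'v det_alg \<Rightarrow> bool" where
  "det_correct A \<longleftrightarrow> (\<forall>G. admissible G \<longrightarrow> outputs_diameter G (A (pverts G)))"

text \<open>A non-measurable event has \<open>measure\<close> 0, so measurability of the success event is part
  of the following requirement.\<close>

definition prob_correct :: "'v prob_alg \<Rightarrow> bool" where
  "prob_correct A \<longleftrightarrow> (\<forall>G. admissible G \<longrightarrow>
     measure coins {\<omega> \<in> space coins. outputs_diameter G (A (pverts G) \<omega>)} \<ge> 2/3)"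

text \<open>
  A worst-case bound over the random choices is expressed by saying that it is not almost surely
  violated. For an algorithm that has read only finitely many coin flips before each of its
  operations this is the same as the existence of a coin sequence attaining the bound; in general
  it is stronger.
\<close>

definition det_needs :: "'v det_alg \<Rightarrow> 'v pair_pre_digraph \<Rightarrow> real \<Rightarrow> bool" where
  "det_needs A G b \<longleftrightarrow> num_ops G (A (pverts G)) \<ge> ereal b"

definition prob_needs :: "'v prob_alg \<Rightarrow> 'v pair_pre_digraph \<Rightarrow> real \<Rightarrow> bool" where
  "prob_needs A G b \<longleftrightarrow> \<not> (AE \<omega> in coins. num_ops G (A (pverts G) \<omega>) < ereal b)"

end

theory Submission
  imports Defs
begin

text \<open>
  Compare the complete bipartite graph on \<open>k + k\<close> vertices, of diameter 2, with the graphs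
  obtained from it by deleting one edge of a fixed perfect matching, all of diameter 3. The
  answer to a query \<open>S\<close> changes with the deletion only if \<open>S\<close> meets one of the two sides exactly
  in an endpoint of the deleted edge, so every query tells the complete graph apart from at most
  two of the \<open>k\<close> others. On the other hand, an algorithm succeeding with probability 2/3 on each
  input must tell every single one of them apart with probability at least 1/3, hence \<open>k/3\<close> of
  them on average.
\<close>

section \<open>Distances\<close>

lemma (in wf_digraph) awalk_cost_one: "awalk_cost (\<lambda>_. 1) p = real (length p)"
  by (induction p) auto

lemma (in pair_wf_digraph) gdist_le:
  assumes "awalk u p v" "length p \<le> d"
  shows "gdist G u v \<le> ereal (real d)"
proof -
  have "gdist G u v \<le> ereal (real (length p))"
    using min_cost_le_walk_cost[OF assms(1), of "\<lambda>_. 1"] by (simp add: gdist_def awalk_cost_one)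
  also have "\<dots> \<le> ereal (real d)"
    using assms(2) by simp
  finally show ?thesis .
qed

lemma (in pair_wf_digraph) le_gdist:
  assumes "\<And>p. awalk u p v \<Longrightarrow> d \<le> length p"
  shows "ereal (real d) \<le> gdist G u v"
  unfolding gdist_def \<mu>_def awalk_cost_one using assms by (auto intro!: INF_greatest)

text \<open>Reduces the diameter to walk lengths: short walks bound every distance by
  \<open>d\<close>, and the pair \<open>a\<close>, \<open>b\<close> attains it.\<close>

lemma (in pair_fin_digraph) gdiameter_eqI:
  assumes short: "\<And>u v. u \<in> pverts G \<Longrightarrow> v \<in> pverts G \<Longrightarrow> \<exists>p. awalk u p v \<and> length p \<le> d"
    and far: "a \<in> pverts G" "b \<in> pverts G" "\<And>p. awalk a p b \<Longrightarrow> d \<le> length p"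
  shows "gdiameter G = ereal (real d)"
proof -
  let ?D = "{gdist G u v | u v. u \<in> pverts G \<and> v \<in> pverts G}"
  have "?D = (\<lambda>(u, v). gdist G u v) ` (pverts G \<times> pverts G)"
    by auto
  then have "finite ?D"
    using pair_finite_verts by simp
  moreover have le: "x \<le> ereal (real d)" if "x \<in> ?D" for x
    using that short gdist_le by blast
  moreover have "gdist G a b = ereal (real d)"
    using le far by (intro antisym le_gdist) auto
  then have "ereal (real d) \<in> ?D"
    using far(1,2) by force
  ultimately show ?thesis
    unfolding gdiameter_def by (intro Max_eqI)
qed

section \<open>The hard inputs\<close>

text \<open>The sides are the even and the odd numbers. The matching edge with index
  \<open>i\<close> joins \<open>2 * i\<close> and \<open>2 * i + 1\<close>, so \<open>div 2\<close>
  recovers the index; \<open>M\<close> holds the indices of the deleted edges. The vertex set does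
  not depend on \<open>M\<close>, so an algorithm starts identically on all these graphs.\<close>

definition bip :: "nat \<Rightarrow> nat set \<Rightarrow> nat pair_pre_digraph" where
  "bip k M = \<lparr>pverts = {..<2 * k},
     parcs = {(u, v). u < 2 * k \<and> v < 2 * k \<and> odd (u + v) \<and> (u div 2 = v div 2 \<longrightarrow> u div 2 \<notin> M)}\<rparr>"

lemma pverts_bip [simp]: "pverts (bip k M) = {..<2 * k}"
  by (simp add: bip_def)

lemma parcs_bip:
  "(u, v) \<in> parcs (bip k M) \<longleftrightarrow>
     u < 2 * k \<and> v < 2 * k \<and> odd (u + v) \<and> (u div 2 = v div 2 \<longrightarrow> u div 2 \<notin> M)"
  by (simp add: bip_def)

lemma sym_parcs_bip: "sym (parcs (bip k M))"
  by (auto simp: sym_def parcs_bip add.commute)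

lemma pair_graph_bip: "pair_graph (bip k M)"
proof
  have "parcs (bip k M) \<subseteq> {..<2 * k} \<times> {..<2 * k}"
    by (auto simp: parcs_bip)
  then show "finite (parcs (bip k M))"
    by (rule finite_subset) simp
  show "symmetric (with_proj (bip k M))"
    using sym_parcs_bip by (simp add: symmetric_def)
qed (auto simp: parcs_bip)

text \<open>Connectedness refers to the symmetric closure, and reachability carries over to it from
  the digraph itself.\<close>

lemma connectedI_awalk:
  assumes "pair_wf_digraph G" "pverts G \<noteq> {}"
    and "\<And>u v. u \<in> pverts G \<Longrightarrow> v \<in> pverts G \<Longrightarrow> \<exists>p. pre_digraph.awalk (with_proj G) u p v"
  shows "Digraph_Component.connected (with_proj G)"
proof -
  interpret pair_wf_digraph G by fact
  have "strongly_connected (with_proj G)"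
    using assms(2,3) reachable_awalk by (intro strongly_connectedI) auto
  then show ?thesis
    unfolding connected_def strongly_connected_def
    by (auto intro: reachable_mk_symmetricI)
qed

lemma length_less_3_cases: "\<not> 3 \<le> length p \<Longrightarrow> p = [] \<or> (\<exists>e. p = [e]) \<or> (\<exists>e f. p = [e, f])"
  by (cases p; cases "tl p"; cases "tl (tl p)") auto

lemma bip_complete:
  assumes "2 \<le> k"
  shows "admissible (bip k {})" "gdiameter (bip k {}) = ereal (real 2)"
proof -
  interpret pair_graph "bip k {}" by (rule pair_graph_bip)
  have walk: "\<exists>p. awalk u p v \<and> length p \<le> 2" if "u \<in> pverts (bip k {})" "v \<in> pverts (bip k {})" for u v
  proof (cases "odd (u + v)")
    case True
    then have "awalk u [(u, v)] v"
      using that by (simp add: awalk_simps parcs_bip)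
    then show ?thesis by - (rule exI, rule conjI, assumption, simp)
  next
    case False
    \<comment> \<open>Both ends lie on the same side (possibly \<open>u = v\<close>), so any vertex
      of the other side can be the midpoint.\<close>
    then have "awalk u [(u, if even u then 1 else 0), (if even u then 1 else 0, v)] v"
      using that assms by (simp add: awalk_simps parcs_bip)
    then show ?thesis by - (rule exI, rule conjI, assumption, simp)
  qed
  \<comment> \<open>0 and 2 are distinct vertices of the same side, hence not adjacent.\<close>
  have far: "2 \<le> length p" if "awalk 0 p 2" for p
  proof (rule ccontr)
    assume "\<not> 2 \<le> length p"
    then consider "p = []" | e where "p = [e]"
      by (cases p) (auto simp: Suc_le_eq)
    then show False
      using that by cases (auto simp: awalk_simps parcs_bip)
  qed
  show diam: "gdiameter (bip k {}) = ereal (real 2)"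
    using walk far assms by (intro gdiameter_eqI[of 2 0 2]) auto
  have "Digraph_Component.connected (with_proj (bip k {}))"
    using walk assms
    by (intro connectedI_awalk) (unfold_locales, auto simp: lessThan_empty_iff bot_nat_def)
  then show "admissible (bip k {})"
    using diam by (simp add: admissible_def pair_graph_bip)
qed

lemma bip_minus_edge:
  assumes "2 \<le> k" "i < k"
  shows "admissible (bip k {i})" "gdiameter (bip k {i}) = ereal (real 3)"
proof -
  let ?G = "bip k {i}"
  interpret pair_graph ?G by (rule pair_graph_bip)
  \<comment> \<open>An intact matching edge, which exists since \<open>2 \<le> k\<close>. Its
    endpoints are still adjacent to the whole opposite side; \<open>opp u\<close> is the one
    opposite to \<open>u\<close>.\<close>
  define j where "j = (if i = 0 then 1 else 0 :: nat)"
  have j: "j < k" "j \<noteq> i"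
    using assms(1) by (auto simp: j_def)
  define opp where "opp u = 2 * j + (if even u then 1 else 0)" for u :: nat
  have arc_opp: "(u, opp u) \<in> parcs ?G \<and> (opp u, u) \<in> parcs ?G" if "u < 2 * k" for u
  proof -
    have "opp u div 2 = j" "odd (u + opp u)" "opp u < 2 * k"
      using j(1) by (auto simp: opp_def)
    then show ?thesis
      using j(2) that by (auto simp: parcs_bip add.commute)
  qed
  have walk: "\<exists>p. awalk u p v \<and> length p \<le> 3" if uv: "u < 2 * k" "v < 2 * k" for u v
  proof (cases "even (u + v)")
    case True
    then have "opp u = opp v"
      by (auto simp: opp_def)
    then have "(opp u, v) \<in> parcs ?G"
      using arc_opp uv by simp
    then have "awalk u [(u, opp u), (opp u, v)] v"
      using arc_opp uv by (simp add: awalk_simps)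
    then show ?thesis by - (rule exI, rule conjI, assumption, simp)
  next
    case False
    \<comment> \<open>For \<open>u\<close> and \<open>v\<close> on different sides these are the two
      ends of the matching edge \<open>j\<close>.\<close>
    have "(opp u, opp v) \<in> parcs ?G"
      using False j by (auto simp: opp_def parcs_bip)
    then have "awalk u [(u, opp u), (opp u, opp v), (opp v, v)] v"
      using arc_opp uv by (simp add: awalk_simps)
    then show ?thesis by - (rule exI, rule conjI, assumption, simp)
  qed
  have far: "3 \<le> length p" if "awalk (2 * i) p (2 * i + 1)" for p
  proof (rule ccontr)
    assume "\<not> 3 \<le> length p"
    then consider "p = []" | e where "p = [e]" | e f where "p = [e, f]"
      using length_less_3_cases by blast
    then show False
    proof cases
      case 1
      then show False using that by (simp add: awalk_simps)
    next
      case (2 e)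
      then show False using that by (cases e) (simp add: awalk_simps parcs_bip)
    next
      case (3 e f)
      \<comment> \<open>Each arc changes the side, so two arcs cannot join vertices of different
        sides.\<close>
      then have "(2 * i, snd e) \<in> parcs ?G" "(snd e, 2 * i + 1) \<in> parcs ?G"
        using that by (cases e; cases f; simp only: awalk_simps fst_conv snd_conv)+
      then have "odd (2 * i + snd e)" "odd (snd e + (2 * i + 1))"
        unfolding parcs_bip by blast+
      then show False by presburger
    qed
  qed
  show diam: "gdiameter ?G = ereal (real 3)"
    using walk far assms by (intro gdiameter_eqI[of 3 "2 * i" "2 * i + 1"]) auto
  have "Digraph_Component.connected (with_proj ?G)"
    using walk assms
    by (intro connectedI_awalk) (unfold_locales, auto simp: lessThan_empty_iff bot_nat_def)
  then show "admissible ?G"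
    using diam by (simp add: admissible_def pair_graph_bip)
qed

section \<open>Runs of a strategy\<close>

text \<open>The dummy value for \<open>Output\<close> is the same for all graphs, so an output never
  tells two graphs apart.\<close>

fun reply :: "'v pair_pre_digraph \<Rightarrow> 'v action \<Rightarrow> 'v set" where
  "reply G (Pre S) = pre_op G S"
| "reply G (Post S) = post_op G S"
| "reply G (Output d) = {}"

lemma histories_step:
  assumes "h \<in> histories G A" "\<And>d. A h \<noteq> Output d"
  shows "h @ [reply G (A h)] \<in> histories G A"
  using assms by (cases "A h") (auto intro: histories.intros)

lemma histories_prefix:
  assumes "h \<in> histories G A" "j < length h"
  shows "take j h \<in> histories G A \<and> (\<forall>d. A (take j h) \<noteq> Output d) \<and> h ! j = reply G (A (take j h))"
  using assms
proof (induction arbitrary: j)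
  case start
  then show ?case by simp
next
  case (pre h S)
  then show ?case by (cases "j = length h") (auto simp: nth_append)
next
  case (post h S)
  then show ?case by (cases "j = length h") (auto simp: nth_append)
qed

text \<open>A strategy is deterministic, so its histories on a graph form a chain: equal prefixes
  lead to the same action and the same reply.\<close>

lemma histories_eqI:
  assumes "h \<in> histories G A" "h' \<in> histories G A" "length h = length h'"
  shows "h = h'"
proof -
  have "take j h = take j h'" if "j \<le> length h" for j
    using that
  proof (induction j)
    case (Suc j)
    then show ?case
      using histories_prefix[OF assms(1), of j] histories_prefix[OF assms(2), of j] assms(3)
      by (simp add: take_Suc_conv_app_nth)
  qed simp
  from this[of "length h"] show ?thesis
    using assms(3) by simp
qed

text \<open>A shorter history would be a proper prefix of the longer one, but no history extends
  beyond an output.\<close>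

lemma histories_output_unique:
  assumes "h \<in> histories G A" "A h = Output d" "h' \<in> histories G A" "A h' = Output d'"
  shows "d = d'"
proof -
  have False if "h1 \<in> histories G A" "A h1 = Output d1" "h2 \<in> histories G A" "length h1 < length h2"
    for h1 h2 d1
  proof -
    have "take (length h1) h2 = h1"
      using histories_prefix[OF that(3,4)] that by (intro histories_eqI) auto
    then show False
      using histories_prefix[OF that(3,4)] that by auto
  qed
  then have "length h = length h'"
    using assms by (metis linorder_less_linear)
  then show ?thesis
    using assms histories_eqI by (metis action.inject(3))
qed

text \<open>It suffices to compare the replies along the run on \<open>G\<close>: by induction the
  run on \<open>H\<close> never leaves it.\<close>

lemma histories_cong:
  assumes "\<And>h. h \<in> histories G A \<Longrightarrow> reply H (A h) = reply G (A h)"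
  shows "histories H A = histories G A"
proof (rule set_eqI, rule iffI)
  fix h
  show "h \<in> histories G A" if "h \<in> histories H A"
    using that
  proof induction
    case (pre h S)
    then show ?case using assms[of h] by (auto intro: histories.intros)
  next
    case (post h S)
    then show ?case using assms[of h] by (auto intro: histories.intros)
  qed (rule histories.start)
  show "h \<in> histories H A" if "h \<in> histories G A"
    using that
  proof induction
    case (pre h S)
    then show ?case using assms[of h] histories.pre[of h H A S] by simp
  next
    case (post h S)
    then show ?case using assms[of h] histories.post[of h H A S] by simp
  qed (rule histories.start)
qed

text \<open>If no query on \<open>G\<close> separated the graphs, both runs would coincide and give
  one answer for two different diameters.\<close>

lemma outputs_diameter_imp_reply_differs:
  assumes "outputs_diameter G A" "outputs_diameter H A" "gdiameter G \<noteq> gdiameter H"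
  shows "\<exists>h\<in>histories G A. reply H (A h) \<noteq> reply G (A h)"
proof (rule ccontr)
  assume "\<not> ?thesis"
  then have "histories H A = histories G A"
    by (intro histories_cong) auto
  then show False
    using assms histories_output_unique[of _ G A] unfolding outputs_diameter_def by metis
qed

text \<open>Union bound over the queries made on \<open>G\<close>: there are at most
  \<open>b\<close> of them, and each separates at most \<open>m\<close> of the graphs
  \<open>H i\<close> from \<open>G\<close>.\<close>

lemma card_reply_differs:
  assumes ops: "num_ops G A < ereal b"
    and m: "\<And>a. finite {i \<in> I. reply (H i) a \<noteq> reply G a} \<and> card {i \<in> I. reply (H i) a \<noteq> reply G a} \<le> m"
  shows "real (card {i \<in> I. \<exists>h\<in>histories G A. reply (H i) (A h) \<noteq> reply G (A h)}) \<le> b * real m"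
proof -
  let ?D = "\<lambda>h. {i \<in> I. reply (H i) (A h) \<noteq> reply G (A h)}"
  \<comment> \<open>The histories at which an operation is about to be performed, one for each
    operation.\<close>
  define Q where "Q = {h \<in> histories G A. \<forall>d. A h \<noteq> Output d}"
  \<comment> \<open>The pending operation yields a history longer by one, which
    \<open>num_ops\<close> counts too.\<close>
  have "real (length h) + 1 < b" if "h \<in> Q" for h
  proof -
    have "ereal (real (length (h @ [reply G (A h)]))) \<le> num_ops G A"
      unfolding num_ops_def using that by (intro SUP_upper) (auto simp: Q_def intro: histories_step)
    then have "ereal (real (length (h @ [reply G (A h)]))) < ereal b"
      using ops by (rule le_less_trans)
    then show ?thesis by (simp add: add.commute)
  qed
  then have sub: "length ` Q \<subseteq> {..<nat \<lfloor>b\<rfloor>}"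
    by (fastforce simp: less_floor_iff zless_nat_eq_int_zless)
  have inj: "inj_on length Q"
    by (auto simp: inj_on_def Q_def intro: histories_eqI)
  have fin: "finite Q"
    using sub inj by (metis finite_imageD finite_lessThan finite_subset)
  have "card Q \<le> nat \<lfloor>b\<rfloor>"
    using card_mono[OF _ sub] card_image[OF inj] by simp
  \<comment> \<open>\<open>nat\<close> truncates negative numbers, so
    \<open>nat \<lfloor>b\<rfloor> \<le> b\<close> requires this; the empty history provides
    it.\<close>
  moreover have "0 \<le> b"
  proof -
    have "ereal (real (length ([] :: 'a set list))) \<le> num_ops G A"
      unfolding num_ops_def by (intro SUP_upper histories.start)
    then have "ereal 0 < ereal b"
      using ops by (metis list.size(3) of_nat_0 le_less_trans)
    then show ?thesis by simp
  qed
  ultimately have cardQ: "real (card Q) \<le> b"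
    by linarith
  have "{i \<in> I. \<exists>h\<in>histories G A. reply (H i) (A h) \<noteq> reply G (A h)} \<subseteq> (\<Union>h\<in>Q. ?D h)"
    unfolding Q_def by force
  then have "card {i \<in> I. \<exists>h\<in>histories G A. reply (H i) (A h) \<noteq> reply G (A h)} \<le> card (\<Union>h\<in>Q. ?D h)"
    using fin m by (intro card_mono) auto
  also have "\<dots> \<le> (\<Sum>h\<in>Q. card (?D h))"
    by (rule card_UN_le[OF fin])
  also have "\<dots> \<le> card Q * m"
    using sum_bounded_above[of Q "\<lambda>h. card (?D h)" m] m by simp
  finally have "real (card {i \<in> I. \<exists>h\<in>histories G A. reply (H i) (A h) \<noteq> reply G (A h)}) \<le> real (card Q * m)"
    by (rule of_nat_mono)
  also have "\<dots> = real (card Q) * real m"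
    by (rule of_nat_mult)
  also have "\<dots> \<le> b * real m"
    using cardQ by (intro mult_right_mono) auto
  finally show ?thesis .
qed

section \<open>Queries to the hard inputs\<close>

lemma post_op_eq_pre_op:
  assumes "sym (parcs G)"
  shows "post_op G S = pre_op G S"
  using assms by (auto simp: post_op_def pre_op_def sym_def)

lemma pre_op_bip_differs:
  assumes "pre_op (bip k {i}) S \<noteq> pre_op (bip k {}) S"
  shows "{s \<in> S. s < 2 * k \<and> even s} = {2 * i} \<or> {s \<in> S. s < 2 * k \<and> odd s} = {2 * i + 1}"
proof -
  obtain v s where s: "s \<in> S" "(v, s) \<in> parcs (bip k {})"
    and v: "\<And>s'. s' \<in> S \<Longrightarrow> (v, s') \<notin> parcs (bip k {i})"
    using assms by (auto simp: pre_op_def parcs_bip)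
  \<comment> \<open>\<open>v\<close> drops out of the result, so every edge from \<open>v\<close> to
    \<open>S\<close> was deleted. Hence the other end of the deleted edge is all that
    \<open>S\<close> contains of the side opposite to \<open>v\<close>.\<close>
  have eq: "s' div 2 = i \<and> v div 2 = i" if "s' \<in> S" "s' < 2 * k" "odd (v + s')" for s'
    using v[OF that(1)] s that by (auto simp: parcs_bip)
  show ?thesis
  proof (cases "even s")
    case True
    then have "{s \<in> S. s < 2 * k \<and> even s} = {2 * i}"
      using s eq by (fastforce simp: parcs_bip)
    then show ?thesis ..
  next
    case False
    then have "{s \<in> S. s < 2 * k \<and> odd s} = {2 * i + 1}"
      using s eq by (fastforce simp: parcs_bip elim!: oddE)
    then show ?thesis ..
  qed
qed

lemma card_reply_bip_differs:
  "finite {i \<in> I. reply (bip k {i}) a \<noteq> reply (bip k {}) a} \<and>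
   card {i \<in> I. reply (bip k {i}) a \<noteq> reply (bip k {}) a} \<le> 2"
proof -
  \<comment> \<open>By symmetry \<open>Post\<close> acts like \<open>Pre\<close>; for
    \<open>Output\<close> the premise is false and any \<open>S\<close> will do.\<close>
  obtain S where S: "reply (bip k {i}) a \<noteq> reply (bip k {}) a \<Longrightarrow>
      pre_op (bip k {i}) S \<noteq> pre_op (bip k {}) S" for i
    by (cases a) (auto simp: post_op_eq_pre_op sym_parcs_bip)
  \<comment> \<open>if one of the two sets is no singleton, the junk value of \<open>THE\<close> only enlarges \<open>D\<close>\<close>
  define D where "D = {(THE s. {s \<in> S. s < 2 * k \<and> even s} = {s}) div 2,
    (THE s. {s \<in> S. s < 2 * k \<and> odd s} = {s}) div 2}"
  have "{i \<in> I. reply (bip k {i}) a \<noteq> reply (bip k {}) a} \<subseteq> D"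
    using pre_op_bip_differs[OF S] by (fastforce simp: D_def)
  moreover have "finite D" "card D \<le> 2"
    by (auto simp: D_def card_insert_if)
  ultimately show ?thesis
    by (meson card_mono finite_subset le_trans)
qed

section \<open>The lower bound\<close>

lemma prob_space_coins: "prob_space coins"
  unfolding coins_def by (intro prob_space.prob_space_stream_space measure_pmf.prob_space_axioms)

text \<open>Positive measure forces measurability, since \<open>measure\<close> is 0 on
  non-measurable sets; the bound is inclusion-exclusion.\<close>

lemma (in prob_space) prob_inter_ge:
  assumes "p \<le> prob A" "p \<le> prob B" "0 < p"
  shows "A \<inter> B \<in> events" "2 * p - 1 \<le> prob (A \<inter> B)"
proof -
  have AB: "A \<in> events" "B \<in> events"
    using assms measure_notin_sets[of A M] measure_notin_sets[of B M] by linarith+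
  then show "A \<inter> B \<in> events" by blast
  have "prob (A \<union> B) = prob A + prob B - prob (A \<inter> B)"
    using AB by (intro measure_Un3) (auto simp: fmeasurable_eq_sets)
  then show "2 * p - 1 \<le> prob (A \<inter> B)"
    using assms prob_le_1[of "A \<union> B"] by linarith
qed

text \<open>By linearity, the left-hand side is the expected number of indices \<open>i\<close> with
  \<open>x \<in> B i\<close>.\<close>

lemma (in prob_space) sum_prob_le:
  assumes "finite I" "\<And>i. i \<in> I \<Longrightarrow> B i \<in> events"
    and "AE x in M. real (card {i \<in> I. x \<in> B i}) \<le> r"
  shows "(\<Sum>i\<in>I. prob (B i)) \<le> r"
proof -
  have int: "integrable M (indicator (B i) :: 'a \<Rightarrow> real)" if "i \<in> I" for i
    using assms(2)[OF that] by (simp add: integrable_indicator_iff emeasure_eq_measure)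
  have "(\<Sum>i\<in>I. prob (B i)) = (\<Sum>i\<in>I. expectation (indicator (B i)))"
    using assms(2) by simp
  also have "\<dots> = expectation (\<lambda>x. \<Sum>i\<in>I. indicator (B i) x)"
    using int by (simp add: Bochner_Integration.integral_sum)
  also have "\<dots> \<le> r"
  proof (rule integral_le_const)
    show "integrable M (\<lambda>x. \<Sum>i\<in>I. indicator (B i) x :: real)"
      using int by (rule Bochner_Integration.integrable_sum)
    have "(\<Sum>i\<in>I. indicator (B i) x) = real (card {i \<in> I. x \<in> B i})" for x
      using assms(1) by (simp add: indicator_def sum.If_cases Int_def)
    then show "AE x in M. (\<Sum>i\<in>I. indicator (B i) x) \<le> r"
      using assms(3) by simp
  qed
  finally show ?thesis .
qed

lemma prob_needs_bip:
  assumes A: "prob_correct A" and k: "2 \<le> k"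
  shows "prob_needs A (bip k {}) (1 / 13 * real (card (pverts (bip k {}))))"
  unfolding prob_needs_def
proof
  interpret prob_space coins by (rule prob_space_coins)
  define b where "b = 1 / 13 * real (card (pverts (bip k {})))"
  define W where "W M = {\<omega> \<in> space coins. outputs_diameter (bip k M) (A {..<2 * k} \<omega>)}" for M
  assume "AE \<omega> in coins. num_ops (bip k {}) (A (pverts (bip k {})) \<omega>)
      < ereal (1 / 13 * real (card (pverts (bip k {}))))"
  then have few: "AE \<omega> in coins. num_ops (bip k {}) (A {..<2 * k} \<omega>) < ereal b"
    by (simp add: b_def)
  have W0: "2/3 \<le> prob (W {})"
    using A bip_complete[OF k] by (force simp: prob_correct_def W_def)
  have Wi: "2/3 \<le> prob (W {i})" if "i < k" for i
    using A bip_minus_edge[OF k that] by (force simp: prob_correct_def W_def)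
  \<comment> \<open>If both runs with the same coins succeed, some query separates the two graphs.
    The separation event itself is not known to be measurable, so the sum runs over these measurable
    subsets of it.\<close>
  have "(\<Sum>i\<in>{..<k}. prob (W {} \<inter> W {i})) \<le> b * real 2"
  proof (rule sum_prob_le)
    show "W {} \<inter> W {i} \<in> events" if "i \<in> {..<k}" for i
      using W0 Wi[of i] that by (intro prob_inter_ge(1)[of "2/3"]) auto
    show "AE \<omega> in coins. real (card {i \<in> {..<k}. \<omega> \<in> W {} \<inter> W {i}}) \<le> b * real 2"
      using few
    proof eventually_elim
      case (elim \<omega>)
      have "{i \<in> {..<k}. \<omega> \<in> W {} \<inter> W {i}} \<subseteq>
        {i \<in> {..<k}. \<exists>h\<in>histories (bip k {}) (A {..<2 * k} \<omega>).
          reply (bip k {i}) (A {..<2 * k} \<omega> h) \<noteq> reply (bip k {}) (A {..<2 * k} \<omega> h)}"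
        using bip_complete(2)[OF k] bip_minus_edge(2)[OF k]
        by (auto simp: W_def intro!: outputs_diameter_imp_reply_differs)
      then have "card {i \<in> {..<k}. \<omega> \<in> W {} \<inter> W {i}} \<le> card
        {i \<in> {..<k}. \<exists>h\<in>histories (bip k {}) (A {..<2 * k} \<omega>).
          reply (bip k {i}) (A {..<2 * k} \<omega> h) \<noteq> reply (bip k {}) (A {..<2 * k} \<omega> h)}"
        by (rule card_mono[rotated]) simp
      then show ?case
        using card_reply_differs[OF elim card_reply_bip_differs, of "{..<k}"] by linarith
    qed
  qed simp
  moreover have "real k * (1/3) \<le> (\<Sum>i\<in>{..<k}. prob (W {} \<inter> W {i}))"
    using prob_inter_ge(2)[OF W0 Wi] sum_bounded_below[of "{..<k}" "1/3" "\<lambda>i. prob (W {} \<inter> W {i})"]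
    by simp
  \<comment> \<open>With \<open>b = 2 * k / 13\<close> this would mean
    \<open>k / 3 \<le> 4 * k / 13\<close>.\<close>
  ultimately show False
    using k by (simp add: b_def)
qed

lemma prob_correct_of_det:
  assumes "det_correct A"
  shows "prob_correct (\<lambda>V _. A V)"
proof -
  interpret prob_space coins by (rule prob_space_coins)
  show ?thesis
    using assms by (auto simp: det_correct_def prob_correct_def prob_space)
qed

text \<open>Without dependence on the coins, a violated bound is violated for every coin sequence,
  hence almost surely.\<close>

lemma det_needs_of_prob_needs:
  assumes "prob_needs (\<lambda>V _. A V) G b"
  shows "det_needs A G b"
  using assms unfolding prob_needs_def det_needs_def by (metis AE_I2 not_le)

theorem mainTheorem8:
  shows "\<exists>c::real. c > 0 \<and>
    (\<forall>A :: nat det_alg. det_correct A \<longrightarrow>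
       (\<forall>N. \<exists>G. admissible G \<and> card (pverts G) \<ge> N \<and> det_needs A G (c * real (card (pverts G))))) \<and>
    (\<forall>A :: nat prob_alg. prob_correct A \<longrightarrow>
       (\<forall>N. \<exists>G. admissible G \<and> card (pverts G) \<ge> N \<and> prob_needs A G (c * real (card (pverts G)))))"
  \<comment> \<open>with \<open>n = 2k\<close>, the argument needs \<open>k/3 > 2cn\<close>, so any \<open>c < 1/12\<close> works\<close>
proof (intro exI[of _ "1/13"] conjI allI impI)
  \<comment> \<open>Adding 2 ensures \<open>2 \<le> k\<close> even for \<open>N = 0\<close>.\<close>
  have large: "admissible (bip (N + 2) {}) \<and> N \<le> card (pverts (bip (N + 2) {}))" for N
    by (simp add: bip_complete(1))
  show "\<exists>G. admissible G \<and> N \<le> card (pverts G) \<and> prob_needs A G (1/13 * real (card (pverts G)))"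
    if "prob_correct A" for A :: "nat prob_alg" and N
    using large[of N] prob_needs_bip[OF that, of "N + 2"] by auto
  show "\<exists>G. admissible G \<and> N \<le> card (pverts G) \<and> det_needs A G (1/13 * real (card (pverts G)))"
    if "det_correct A" for A :: "nat det_alg" and N
    using large[of N] prob_needs_bip[OF prob_correct_of_det[OF that], of "N + 2"]
      det_needs_of_prob_needs by fastforce
qed simp

end
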